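(* Let $n\ge 2$ and $k\ge 2$. The Seidel energy of the hyperstar $S_n^k$ is $$SE(S_n^k)=(n-1)(3k-5)-(2k-3)+\sqrt{(k-1)^2(n-3)^2+2(k-1)(3n-5)+1}.$$
   Context: A hypergraph $G^*=(V,E)$ has a finite vertex set $V=\{v_1,\dots,v_N\}$ and a finite set $E$ of hyperedges, each a subset of $V$. Its adjacency matrix $A=(a_{ij})$ has $a_{ij}=|\{e\in E:\{v_i,v_j\}\subset e\}|$ for $i\ne j$ and $a_{ii}=0$. Its Seidel matrix is $S=J_N-I_N-2A$ ($J_N$ all-ones matrix, $I_N$ identity). The Seidel energy $SE(G^* )$ is the sum of the absolute values of the eigenvalues of $S$, counted with multiplicity. The hyperstar $S_n^k$ has the $(n-1)(k-1)+1$ vertices $v_{0,0}$ and $v_{i,j}$ ($1\le i\le n-1$, $1\le j\le k-1$), and the $n-1$ hyperedges $\{v_{0,0},v_{i,1},\dots,v_{i,k-1}\}$, $1\le i\le n-1$. *)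

theory Defs
  imports "Jordan_Normal_Form.Char_Poly" Complex_Main
begin

locale hypergraph =
  fixes V :: "'a set" and E :: "'a set set"
  assumes finite_V: "finite V"
    and edges_subset: "e \<in> E \<Longrightarrow> e \<subseteq> V"

text \<open>
  Matrices are indexed by positions in a list \<open>vs\<close> that enumerates the vertex set; a statement
  about the hypergraph itself quantifies over all distinct lists \<open>vs\<close> with \<open>set vs = V\<close>.
\<close>

definition adjacency_mat :: "'a list \<Rightarrow> 'a set set \<Rightarrow> real mat" where
  "adjacency_mat vs E = mat (length vs) (length vs)
     (\<lambda>(i, j). if i = j then 0 else real (card {e \<in> E. {vs ! i, vs ! j} \<subseteq> e}))"

definition all_ones_mat :: "nat \<Rightarrow> real mat" where
  "all_ones_mat N = mat N N (\<lambda>_. 1)"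

definition seidel_mat :: "'a list \<Rightarrow> 'a set set \<Rightarrow> real mat" where
  "seidel_mat vs E =
     all_ones_mat (length vs) - 1\<^sub>m (length vs) - 2 \<cdot>\<^sub>m adjacency_mat vs E"

text \<open>
  Eigenvalues are taken over the complex numbers, so that none is omitted by definition, and
  their multiplicity is the algebraic one; the matrices in question are real symmetric, hence all
  eigenvalues are real and the two notions of multiplicity agree.
\<close>

definition mat_energy :: "real mat \<Rightarrow> real" where
  "mat_energy M = (let C = map_mat complex_of_real M in
     \<Sum>x | eigenvalue C x. real (order x (char_poly C)) * cmod x)"

definition seidel_energy :: "'a list \<Rightarrow> 'a set set \<Rightarrow> real" where
  "seidel_energy vs E = mat_energy (seidel_mat vs E)"

text \<open>The pair \<open>(i, j)\<close> stands for the vertex \<open>v\<^sub>i\<^sub>,\<^sub>j\<close>.\<close>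

definition hyperstar_vertices :: "nat \<Rightarrow> nat \<Rightarrow> (nat \<times> nat) set" where
  "hyperstar_vertices n k = insert (0, 0) ({1..n - 1} \<times> {1..k - 1})"

definition hyperstar_edges :: "nat \<Rightarrow> nat \<Rightarrow> (nat \<times> nat) set set" where
  "hyperstar_edges n k = (\<lambda>i. insert (0, 0) ({i} \<times> {1..k - 1})) ` {1..n - 1}"

lemma hypergraph_hyperstar: "hypergraph (hyperstar_vertices n k) (hyperstar_edges n k)"
  by unfold_locales (auto simp: hyperstar_vertices_def hyperstar_edges_def)

lemma card_hyperstar_vertices: "card (hyperstar_vertices n k) = (n - 1) * (k - 1) + 1"
  by (simp add: hyperstar_vertices_def)

end

theory Submission imports Defs begin

text \<open>
  Write \<open>m = n - 1\<close> and \<open>p = k - 1\<close>. The entries of \<open>S - I\<close> depend only on the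
  first coordinates of the two vertices, so \<open>S - I\<close> factors through the \<open>m + 1\<close> classes of vertices. Sylvester's
  determinant identity reduces the characteristic polynomial of \<open>S - I\<close> to that of a matrix of
  size \<open>m + 1\<close>; this one is a rank-two perturbation of \<open>-2pI\<close>, so the identity applies once more
  and leaves a \<open>2 \<times> 2\<close> determinant. Hence the eigenvalues of \<open>S\<close> are \<open>1\<close> with multiplicity
  \<open>m(p - 1)\<close>, \<open>1 - 2p\<close> with multiplicity \<open>m - 1\<close>, and the roots of
  \<open>x\<^sup>2 - (mp - 2p + 1)x - mp\<close>. The latter have opposite signs, so the sum of their absolute values
  is the square root of the discriminant.
\<close>

section \<open>Determinant identities, root multiplicities and energy\<close>

lemma sylvester_det_identity:
  fixes A B :: "'a :: idom mat"
  assumes A: "A \<in> carrier_mat n m" and B: "B \<in> carrier_mat m n"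
  shows "y ^ m * det (y \<cdot>\<^sub>m 1\<^sub>m n - A * B) = y ^ n * det (y \<cdot>\<^sub>m 1\<^sub>m m - B * A)"
proof -
  \<comment> \<open>Block column operations evaluate \<open>det M\<close> twice: \<open>L\<close>
    clears \<open>B\<close>, and \<open>R\<close> clears \<open>A\<close>. Scaling by
    \<open>y\<close> inside \<open>R\<close> replaces a division by \<open>y\<close>, so
    \<open>y = 0\<close> is covered as well.\<close>
  define M where "M = four_block_mat (y \<cdot>\<^sub>m 1\<^sub>m n) A B (1\<^sub>m m)"
  define L where "L = four_block_mat (1\<^sub>m n) (0\<^sub>m n m) (- B) (1\<^sub>m m)"
  define R where "R = four_block_mat (1\<^sub>m n) (- A) (0\<^sub>m m n) (y \<cdot>\<^sub>m 1\<^sub>m m)"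
  have M: "M \<in> carrier_mat (n + m) (n + m)" and L: "L \<in> carrier_mat (n + m) (n + m)"
    and R: "R \<in> carrier_mat (n + m) (n + m)"
    using A B by (auto simp: M_def L_def R_def)
  have prodL: "M * L = four_block_mat (y \<cdot>\<^sub>m 1\<^sub>m n - A * B) A (0\<^sub>m m n) (1\<^sub>m m)"
    unfolding M_def L_def using A B
    by (subst mult_four_block_mat[of _ n n _ m _ m _ _ n _ m])
      (auto intro!: cong_four_block_mat)
  have prodR: "M * R = four_block_mat (y \<cdot>\<^sub>m 1\<^sub>m n) (0\<^sub>m n m) B (y \<cdot>\<^sub>m 1\<^sub>m m - B * A)"
    unfolding M_def R_def using A B
    by (subst mult_four_block_mat[of _ n n _ m _ m _ _ n _ m])
      (auto intro!: cong_four_block_mat)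
  have "det (M * L) = det (y \<cdot>\<^sub>m 1\<^sub>m n - A * B)"
    unfolding prodL using A B by (subst det_four_block_mat_lower_left_zero[of _ n _ m]) auto
  moreover have "det L = 1"
    unfolding L_def using A B by (subst det_four_block_mat_upper_right_zero[of _ n _ m]) auto
  ultimately have dM: "det M = det (y \<cdot>\<^sub>m 1\<^sub>m n - A * B)"
    using det_mult[OF M L] by simp
  have "det (M * R) = y ^ n * det (y \<cdot>\<^sub>m 1\<^sub>m m - B * A)"
    unfolding prodR using A B by (subst det_four_block_mat_upper_right_zero[of _ n _ m]) auto
  moreover have "det R = y ^ m"
    unfolding R_def using A B by (subst det_four_block_mat_lower_left_zero[of _ n _ m]) auto
  ultimately show ?thesis
    using det_mult[OF M R] dM by (simp add: mult.commute)
qed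

lemma poly_char_poly:
  fixes A :: "'a :: field mat"
  assumes A: "A \<in> carrier_mat n n"
  shows "poly (char_poly A) x = det (x \<cdot>\<^sub>m 1\<^sub>m n - A)"
  unfolding char_poly_def
  by (rule poly_det_cong[of _ n]) (use A in \<open>auto simp: char_poly_matrix_def\<close>)

lemma det_two:
  fixes A :: "'a :: idom mat"
  assumes "A \<in> carrier_mat 2 2"
  shows "det A = A $$ (0, 0) * A $$ (1, 1) - A $$ (0, 1) * A $$ (1, 0)"
proof -
  have "det A = (\<Sum>i<2. A $$ (i, 0) * cofactor A i 0)"
    by (rule laplace_expansion_column[OF assms]) simp
  then show ?thesis
    using assms by (simp add: numeral_2_eq_2 cofactor_def mat_delete_def det_single)
qed

lemma order_prod_linear_factors:
  fixes as :: "'a :: field list"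
  shows "order x (\<Prod>a\<leftarrow>as. [:- a, 1:]) = count_list as x"
proof (induction as)
  case (Cons a as)
  have "(\<Prod>a\<leftarrow>a # as. [:- a, 1:]) \<noteq> 0"
    by (subst prod_list_zero_iff) auto
  then have "order x (\<Prod>a\<leftarrow>a # as. [:- a, 1:]) = order x [:- a, 1:] + count_list as x"
    using Cons.IH by (simp add: order_mult del: mult_pCons_left)
  then show ?case by (simp add: order_linear' del: mult_pCons_left)
qed simp

lemma sum_list_map_conv_sum_count:
  fixes f :: "'a \<Rightarrow> 'b :: semiring_1"
  shows "(\<Sum>x\<leftarrow>xs. f x) = (\<Sum>x\<in>set xs. of_nat (count_list xs x) * f x)"
proof (induction xs)
  case (Cons c cs)
  have "(\<Sum>x\<in>set (c # cs). of_nat (count_list (c # cs) x) * f x) =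
      (\<Sum>x\<in>insert c (set cs). (if x = c then f x else 0) + of_nat (count_list cs x) * f x)"
    by (rule sum.cong) (auto simp: algebra_simps)
  also have "\<dots> = f c + (\<Sum>x\<in>insert c (set cs). of_nat (count_list cs x) * f x)"
    by (simp add: sum.distrib sum.delta del: sum.insert sum.insert_if)
  also have "(\<Sum>x\<in>insert c (set cs). of_nat (count_list cs x) * f x) =
      (\<Sum>x\<in>set cs. of_nat (count_list cs x) * f x)"
    \<comment> \<open>If \<open>c\<close> does not occur in \<open>cs\<close>, its count there is
      zero, so dropping it is harmless.\<close>
    by (rule sum.mono_neutral_right) auto
  finally show ?case using Cons.IH by simp
qed simp

text \<open>A splitting over the reals stays one over the complex numbers, so no non-real eigenvalue
  occurs, and each algebraic multiplicity is the number of occurrences in \<open>as\<close>.\<close>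

lemma mat_energy_linear_factors:
  assumes M: "M \<in> carrier_mat n n" and cp: "char_poly M = (\<Prod>a\<leftarrow>as. [:- a, 1:])"
  shows "mat_energy M = (\<Sum>a\<leftarrow>as. \<bar>a\<bar>)"
proof -
  define C where "C = map_mat complex_of_real M"
  define cs where "cs = map complex_of_real as"
  have C: "C \<in> carrier_mat n n" using M by (simp add: C_def)
  interpret map_poly_comm_ring_hom complex_of_real ..
  have "map_poly complex_of_real (\<Prod>a\<leftarrow>as. [:- a, 1:]) = (\<Prod>a\<leftarrow>cs. [:- a, 1:])"
    unfolding cs_def by (induction as) (simp_all add: hom_mult del: mult_pCons_left mult_pCons_right)
  then have cpC: "char_poly C = (\<Prod>a\<leftarrow>cs. [:- a, 1:])"
    unfolding C_def of_real_hom.char_poly_hom[OF M] cp .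
  have "poly (\<Prod>a\<leftarrow>xs. [:- a, 1:]) x = 0 \<longleftrightarrow> x \<in> set xs" for x :: complex and xs
    by (induction xs) (auto simp: algebra_simps)
  then have ev: "{x. eigenvalue C x} = set cs"
    by (auto simp: eigenvalue_root_char_poly[OF C] cpC)
  have "mat_energy M = (\<Sum>x\<in>set cs. real (count_list cs x) * cmod x)"
    by (simp add: mat_energy_def Let_def C_def[symmetric] ev cpC order_prod_linear_factors)
  also have "\<dots> = (\<Sum>c\<leftarrow>cs. cmod c)"
    by (simp add: sum_list_map_conv_sum_count)
  also have "\<dots> = (\<Sum>a\<leftarrow>as. \<bar>a\<bar>)"
    by (simp add: cs_def o_def)
  finally show ?thesis .
qed

section \<open>Vertex classes and shared edges of the hyperstar\<close>

locale hyperstar =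
  fixes m p :: nat and vs :: "(nat \<times> nat) list"
  assumes m: "m \<ge> 1" and p: "p \<ge> 1"
    and distinct_vs: "distinct vs" and set_vs: "set vs = hyperstar_vertices (m + 1) (p + 1)"
begin

abbreviation N :: nat where "N \<equiv> length vs"

text \<open>Class 0 is the centre alone; class \<open>i \<ge> 1\<close> consists of the
  \<open>p\<close> other vertices of the \<open>i\<close>-th edge.\<close>

abbreviation cls :: "nat \<Rightarrow> nat" where "cls r \<equiv> fst (vs ! r)"

lemma length_vs: "N = m * p + 1"
  using distinct_card[OF distinct_vs] by (simp add: set_vs card_hyperstar_vertices)

lemma nth_vs:
  assumes "r < N"
  shows "vs ! r = (0, 0) \<or> fst (vs ! r) \<in> {1..m} \<and> snd (vs ! r) \<in> {1..p}"
  using nth_mem[OF assms] by (auto simp: set_vs hyperstar_vertices_def)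

lemma cls_le: "r < N \<Longrightarrow> cls r \<le> m"
  using nth_vs[of r] by auto

lemma card_cls:
  assumes "j \<le> m"
  shows "card {r. r < N \<and> cls r = j} = (if j = 0 then 1 else p)"
proof -
  have "bij_betw ((!) vs) {r \<in> {..<N}. cls r = j} {v \<in> set vs. fst v = j}"
    using bij_betw_nth[OF distinct_vs refl refl]
    by (auto simp: bij_betw_def inj_on_def set_conv_nth)
  then have "card {r. r < N \<and> cls r = j} = card {v \<in> set vs. fst v = j}"
    by (simp add: bij_betw_same_card)
  also have "{v \<in> set vs. fst v = j} = (if j = 0 then {(0, 0)} else {j} \<times> {1..p})"
    using assms by (auto simp: set_vs hyperstar_vertices_def)
  finally show ?thesis by simp
qed

text \<open>Different edges meet only in the centre, so two distinct vertices share at most one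
  edge, and the classes decide whether they do.\<close>

lemma card_edges_through:
  assumes "r < N" "s < N" "r \<noteq> s"
  shows "card {e \<in> hyperstar_edges (m + 1) (p + 1). {vs ! r, vs ! s} \<subseteq> e} =
    (if cls r = 0 \<or> cls s = 0 \<or> cls r = cls s then 1 else 0)"
proof -
  define edge where "edge = (\<lambda>i::nat. insert (0::nat, 0::nat) ({i} \<times> {1..p}))"
  have E: "hyperstar_edges (m + 1) (p + 1) = edge ` {1..m}"
    by (simp add: hyperstar_edges_def edge_def)
  have inj: "inj_on edge {1..m}"
  proof (rule inj_onI)
    fix i j assume "i \<in> {1..m}" "j \<in> {1..m}" and eq: "edge i = edge j"
    \<comment> \<open>Since \<open>p \<ge> 1\<close>, each edge has a vertex other than the centre,
      which identifies it.\<close>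
    have "(i, 1) \<in> edge i" using p by (simp add: edge_def)
    then have "(i, 1) \<in> edge j" by (simp add: eq)
    then show "i = j" using \<open>i \<in> {1..m}\<close> by (simp add: edge_def)
  qed
  have mem: "vs ! t \<in> edge i \<longleftrightarrow> cls t = 0 \<or> cls t = i" if "t < N" "i \<in> {1..m}" for t i
    using nth_vs[OF that(1)] that(2) by (cases "vs ! t") (auto simp: edge_def)
  have not_both: "\<not> (cls r = 0 \<and> cls s = 0)"
    using nth_vs[OF assms(1)] nth_vs[OF assms(2)] assms distinct_vs
    by (metis atLeastAtMost_iff not_one_le_zero nth_eq_iff_index_eq)
  have "{e \<in> edge ` {1..m}. {vs ! r, vs ! s} \<subseteq> e} =
      edge ` {i \<in> {1..m}. (cls r = 0 \<or> cls r = i) \<and> (cls s = 0 \<or> cls s = i)}"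
    using mem assms by auto
  then have "card {e \<in> edge ` {1..m}. {vs ! r, vs ! s} \<subseteq> e} =
      card {i \<in> {1..m}. (cls r = 0 \<or> cls r = i) \<and> (cls s = 0 \<or> cls s = i)}"
    by (simp only: card_image[OF inj_on_subset[OF inj Collect_restrict]])
  also have "{i \<in> {1..m}. (cls r = 0 \<or> cls r = i) \<and> (cls s = 0 \<or> cls s = i)} =
      (if cls r \<noteq> 0 \<and> (cls s = 0 \<or> cls r = cls s) then {cls r}
       else if cls r = 0 \<and> cls s \<noteq> 0 then {cls s} else {})"
    using not_both cls_le[OF assms(1)] cls_le[OF assms(2)] by auto
  also have "card \<dots> = (if cls r = 0 \<or> cls s = 0 \<or> cls r = cls s then 1 else 0)"
    using not_both by auto
  finally show ?thesis unfolding E .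
qed

section \<open>Factorization through the classes\<close>

definition S :: "real mat" where "S = seidel_mat vs (hyperstar_edges (m + 1) (p + 1))"

lemma S_carrier: "S \<in> carrier_mat N N"
  by (auto simp: S_def seidel_mat_def all_ones_mat_def adjacency_mat_def)

text \<open>Off the diagonal, a Seidel entry is -1 if the vertices share an edge and 1 otherwise.
  Subtracting the identity turns the zero diagonal into -1, the value that already holds within a
  class.\<close>

definition g :: "nat \<Rightarrow> nat \<Rightarrow> real" where
  "g i j = (if i = 0 \<or> j = 0 \<or> i = j then - 1 else 1)"

definition W :: "real mat" where
  "W = mat N (m + 1) (\<lambda>(r, i). if cls r = i then 1 else 0)"

text \<open>This is the matrix of the values \<open>g i j\<close> times the transpose of the class
  indicator matrix \<open>W\<close>.\<close>

definition GW :: "real mat" where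
  "GW = mat (m + 1) N (\<lambda>(i, r). g i (cls r))"

lemma W_GW: "W * GW = S - 1\<^sub>m N"
proof (rule eq_matI)
  fix r s assume "r < dim_row (S - 1\<^sub>m N)" "s < dim_col (S - 1\<^sub>m N)"
  then have rs: "r < N" "s < N" by simp_all
  have "(W * GW) $$ (r, s) = (\<Sum>i<m + 1. (if cls r = i then 1 else 0) * g i (cls s))"
    using rs by (simp add: W_def GW_def scalar_prod_def atLeast0LessThan del: sum.lessThan_Suc)
  also have "\<dots> = (\<Sum>i<m + 1. if i = cls r then g i (cls s) else 0)"
    by (rule sum.cong) auto
  also have "\<dots> = g (cls r) (cls s)"
    using cls_le[OF rs(1)] by (subst sum.delta) auto
  also have "\<dots> = (S - 1\<^sub>m N) $$ (r, s)"
    using rs card_edges_through[OF rs]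
    by (auto simp: S_def seidel_mat_def all_ones_mat_def adjacency_mat_def g_def)
  finally show "(W * GW) $$ (r, s) = (S - 1\<^sub>m N) $$ (r, s)" .
qed (use S_carrier in \<open>auto simp: W_def GW_def\<close>)

text \<open>Column \<open>j\<close> of \<open>GW * W\<close> is that of \<open>g\<close> scaled by
  the size of class \<open>j\<close>. Adding \<open>2 * p\<close> on the diagonal makes all rows
  except row 0 equal to (-1, p, ..., p). \<open>Y\<close> stores the two distinct rows, and
  \<open>X\<close> distributes them.\<close>

definition X :: "real mat" where
  "X = mat (m + 1) 2 (\<lambda>(i, j). if (i = 0) = (j = 0) then 1 else 0)"

definition Y :: "real mat" where
  "Y = mat 2 (m + 1) (\<lambda>(i, j). if i = 0 then (if j = 0 then 2 * real p - 1 else - real p)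
     else (if j = 0 then - 1 else p))"

lemma GW_W: "GW * W = X * Y - (2 * real p) \<cdot>\<^sub>m 1\<^sub>m (m + 1)"
proof (rule eq_matI)
  fix i j assume "i < dim_row (X * Y - (2 * real p) \<cdot>\<^sub>m 1\<^sub>m (m + 1))"
    "j < dim_col (X * Y - (2 * real p) \<cdot>\<^sub>m 1\<^sub>m (m + 1))"
  then have ij: "i \<le> m" "j \<le> m" by simp_all
  have "(GW * W) $$ (i, j) = (\<Sum>r<N. g i (cls r) * (if cls r = j then 1 else 0))"
    using ij by (simp add: W_def GW_def scalar_prod_def atLeast0LessThan)
  also have "\<dots> = (\<Sum>r<N. if cls r = j then g i j else 0)"
    by (rule sum.cong) auto
  also have "\<dots> = real (card {r. r < N \<and> cls r = j}) * g i j"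
    by (subst sum.If_cases) (auto simp: Int_def)
  also have "\<dots> = (X * Y - (2 * real p) \<cdot>\<^sub>m 1\<^sub>m (m + 1)) $$ (i, j)"
    using ij p by (auto simp: card_cls X_def Y_def g_def scalar_prod_def numeral_2_eq_2)
  finally show "(GW * W) $$ (i, j) = (X * Y - (2 * real p) \<cdot>\<^sub>m 1\<^sub>m (m + 1)) $$ (i, j)" .
qed (auto simp: W_def GW_def X_def Y_def)

lemma det_Y_X:
  "det (z \<cdot>\<^sub>m 1\<^sub>m 2 - Y * X) = (z - 2 * real p + 1) * (z - p * m) - p * m"
proof -
  have YX: "Y * X = mat 2 2 (\<lambda>(i, j). if i = 0 then (if j = 0 then 2 * real p - 1 else - (real p * m))
      else (if j = 0 then - 1 else p * m))"
    by (rule eq_matI)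
      (auto simp: X_def Y_def scalar_prod_def less_2_cases_iff sum.atLeast0_lessThan_Suc_shift
        simp del: sum.op_ivl_Suc)
  show ?thesis unfolding YX
    by (subst det_two) (auto simp: algebra_simps)
qed

section \<open>Spectrum and energy\<close>

lemma char_poly_S:
  "char_poly S = [:- 1, 1:] ^ (m * (p - 1)) * [:2 * real p - 1, 1:] ^ (m - 1) *
     [:- (real m * p), - (real m * p - 2 * real p + 1), 1:]"
proof -
  define u :: "real poly" where "u = [:- 1, 1:]"
  define v :: "real poly" where "v = [:2 * real p - 1, 1:]"
  define q :: "real poly" where "q = [:- (real m * p), - (real m * p - 2 * real p + 1), 1:]"
  \<comment> \<open>The powers left over from the two determinant identities stay on both sides, so
    no point \<open>x\<close> is exceptional; they are cancelled later as nonzero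
    polynomials.\<close>
  have "poly (u ^ (m + 1) * (v ^ 2 * char_poly S)) x = poly (u ^ N * (v ^ (m + 1) * q)) x" for x
  proof -
    \<comment> \<open>\<open>y\<close> is the spectral parameter for \<open>W * GW\<close>, the
      shift of \<open>S\<close> by the identity, and \<open>z\<close> the one for
      \<open>X * Y\<close>, the shift of \<open>GW * W\<close> by \<open>2 * p\<close>.\<close>
    define y where "y = x - 1"
    define z where "z = y + 2 * real p"
    have uvq: "poly u x = y" "poly v x = z" "poly q x = (z - 2 * real p + 1) * (z - p * m) - p * m"
      by (simp_all add: u_def v_def q_def z_def y_def algebra_simps)
    have "x \<cdot>\<^sub>m 1\<^sub>m N - S = y \<cdot>\<^sub>m 1\<^sub>m N - W * GW"
      unfolding W_GW using S_carrier by (intro eq_matI) (auto simp: y_def)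
    then have 1: "y ^ (m + 1) * poly (char_poly S) x = y ^ N * det (y \<cdot>\<^sub>m 1\<^sub>m (m + 1) - GW * W)"
      using sylvester_det_identity[of W N "m + 1" GW y]
      by (simp add: poly_char_poly[OF S_carrier] W_def GW_def)
    have "y \<cdot>\<^sub>m 1\<^sub>m (m + 1) - GW * W = z \<cdot>\<^sub>m 1\<^sub>m (m + 1) - X * Y"
      unfolding GW_W by (intro eq_matI) (auto simp: z_def X_def Y_def)
    then have 2: "z ^ 2 * det (y \<cdot>\<^sub>m 1\<^sub>m (m + 1) - GW * W) =
        z ^ (m + 1) * det (z \<cdot>\<^sub>m 1\<^sub>m 2 - Y * X)"
      using sylvester_det_identity[of X "m + 1" 2 Y z] by (simp add: X_def Y_def)
    have "poly (u ^ (m + 1) * (v ^ 2 * char_poly S)) x =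
        z ^ 2 * (y ^ (m + 1) * poly (char_poly S) x)"
      by (simp add: uvq del: power_Suc)
    also have "\<dots> = y ^ N * (z ^ 2 * det (y \<cdot>\<^sub>m 1\<^sub>m (m + 1) - GW * W))"
      unfolding 1 by simp
    also have "\<dots> = poly (u ^ N * (v ^ (m + 1) * q)) x"
      unfolding 2 det_Y_X by (simp add: uvq)
    finally show ?thesis .
  qed
  then have "u ^ (m + 1) * (v ^ 2 * char_poly S) = u ^ N * (v ^ (m + 1) * q)"
    by (simp flip: poly_eq_poly_eq_iff add: fun_eq_iff)
  moreover have "N = (m + 1) + m * (p - 1)" "m + 1 = 2 + (m - 1)"
    using m p by (simp_all add: length_vs algebra_simps)
  then have "u ^ N = u ^ (m + 1) * u ^ (m * (p - 1))" "v ^ (m + 1) = v ^ 2 * v ^ (m - 1)"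
    by (metis power_add)+
  ultimately have "(u ^ (m + 1) * v ^ 2) * char_poly S =
      (u ^ (m + 1) * v ^ 2) * (u ^ (m * (p - 1)) * v ^ (m - 1) * q)"
    by (simp only: ac_simps)
  moreover have "u ^ (m + 1) * v ^ 2 \<noteq> 0" by (simp add: u_def v_def del: power_Suc)
  ultimately show ?thesis
    unfolding u_def v_def q_def by (metis mult_left_cancel)
qed

lemma energy:
  "mat_energy S = real m * (3 * real p - 2) - (2 * real p - 1) +
     sqrt ((real m * p - 2 * real p + 1)\<^sup>2 + 4 * (real m * p))"
proof -
  define b c where "b = real m * p - 2 * real p + 1" and "c = real m * p"
  define d where "d = sqrt (b\<^sup>2 + 4 * c)"
  define as where "as = replicate (m * (p - 1)) 1 @ replicate (m - 1) (1 - 2 * real p) @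
     [(b + d) / 2, (b - d) / 2]"
  have c: "c \<ge> 0" by (simp add: c_def)
  have d2: "d\<^sup>2 = b\<^sup>2 + 4 * c" using c by (simp add: d_def)
  have "\<bar>b\<bar> \<le> d" unfolding d_def using c by (intro real_le_rsqrt) simp
  \<comment> \<open>The bound on \<open>b\<close> gives
    \<open>(b - d) / 2 \<le> 0 \<le> (b + d) / 2\<close>, so the absolute values add up to the
    difference of the roots.\<close>
  then have roots: "\<bar>(b + d) / 2\<bar> + \<bar>(b - d) / 2\<bar> = d"
    by (cases "b \<ge> 0"; cases "b \<le> 0") (auto simp: abs_if field_simps)
  have "(b + d) / 2 * ((b - d) / 2) = - c"
    using d2 by (simp add: field_simps power2_eq_square)
  then have "[:- ((b + d) / 2), 1:] * [:- ((b - d) / 2), 1:] = [:- c, - b, 1:]"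
    by (simp add: field_simps)
  then have "char_poly S = (\<Prod>a\<leftarrow>as. [:- a, 1:])"
    unfolding char_poly_S b_def[symmetric] unfolding c_def[symmetric]
    by (simp add: as_def prod_list_replicate mult.assoc del: mult_pCons_left mult_pCons_right)
  then have "mat_energy S = (\<Sum>a\<leftarrow>as. \<bar>a\<bar>)"
    by (rule mat_energy_linear_factors[OF S_carrier])
  also have "\<dots> = real (m * (p - 1)) + real (m - 1) * (2 * real p - 1) + d"
    using roots p by (simp add: as_def sum_list_replicate)
  finally show ?thesis
    using m p by (simp add: d_def b_def c_def of_nat_diff algebra_simps)
qed

end

theorem theorem4p3:
  fixes n k :: nat and vs :: "(nat \<times> nat) list"
  assumes "n \<ge> 2" and "k \<ge> 2"
    and "distinct vs" and "set vs = hyperstar_vertices n k"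
  shows "seidel_energy vs (hyperstar_edges n k) =
    (real n - 1) * (3 * real k - 5) - (2 * real k - 3) +
    sqrt ((real k - 1)\<^sup>2 * (real n - 3)\<^sup>2 + 2 * (real k - 1) * (3 * real n - 5) + 1)"
proof -
  obtain m p where mp: "n = m + 1" "k = p + 1" "m \<ge> 1" "p \<ge> 1"
    using assms(1,2) that[of "n - 1" "k - 1"] by simp
  interpret hyperstar m p vs
    by unfold_locales (use assms mp in auto)
  \<comment> \<open>Here \<open>m * p - 2 * p + 1 = p * (n - 3) + 1\<close>, and the terms linear in
    \<open>p\<close> combine as
    \<open>2 * p * (n - 3) + 4 * p * (n - 1) = 2 * p * (3 * n - 5)\<close>.\<close>
  have disc: "(real m * p - 2 * real p + 1)\<^sup>2 + 4 * (real m * p) =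
      (real k - 1)\<^sup>2 * (real n - 3)\<^sup>2 + 2 * (real k - 1) * (3 * real n - 5) + 1"
    by (simp add: mp power2_eq_square algebra_simps)
  show ?thesis
    using energy unfolding disc by (simp add: seidel_energy_def S_def mp algebra_simps)
qed

end
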